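(* Let $X\subset\mathbb{R}^d$ be a complementary regular set, let $f:\mathbb{R}^d\to\mathbb{R}$ be $C^2$, and let $a<b$ be reals such that every $t\in[a,b]$ is a regular value of $f_{|X}$. Then $X_a=X\cap f^{-1}(-\infty,a]$ is a deformation retract of $X_b=X\cap f^{-1}(-\infty,b]$.
   Context: Notation: $d_A(x)=\inf_{a\in A}\|x-a\|$; Clarke gradient $\partial\phi(x)$ of a locally Lipschitz $\phi$: convex hull of limits $\lim_i\nabla\phi(x_i)$, $x_i\to x$, $\phi$ differentiable at $x_i$; $\Delta(B)=\inf_{b\in B}\|b\|$. Complement set $\mathcal{C}A:=\overline{\mathbb{R}^d\setminus A}$; $\partial A=\overline A\setminus\operatorname{int}A$. Reach of closed $A$: supremum of $t\ge0$ such that every $x$ with $d_A(x)<t$ has a unique nearest point in $A$. For $\mu\in(0,1]$, $\operatorname{reach}_\mu(A)=\sup\{s:\Delta(\partial d_A(x))\ge\mu\text{ for all }x\text{ with }0<d_A(x)\le s\}$. A compact $X$ is complementary regular if $\overline{\operatorname{int}X}=X$, $\operatorname{reach}_\mu(X)>0$ for some $\mu\in(0,1]$ and $\operatorname{reach}(\mathcal{C}X)>0$. Tangent cone $\operatorname{Tan}(A,x)$: cone generated by limits of $(x_n-x)/\|x_n-x\|$, $x_n\in A\setminus\{x\}$, $x_n\to x$; polar cone $B^\circ=\{u:\langle u,b\rangle\le 0\ \forall b\in B\}$; for closed $A$ of positive reach $\operatorname{Nor}(A,x)=\operatorname{Tan}(A,x)^\circ$. For complementary regular $X$, $\operatorname{Nor}(X,x):=-\operatorname{Nor}(\mathcal{C}X,x)$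 for $x\in\partial X$ and $\{0\}$ for $x\in\operatorname{int}X$. A point $x\in X$ is a critical point of $f_{|X}$ if $\nabla f(x)\in-\operatorname{Nor}(X,x)$; $t$ is a regular value of $f_{|X}$ if $f^{-1}(t)\cap X$ contains no critical point. *)

theory Defs
  imports "HOL-Analysis.Analysis"
begin

definition clarke_grad :: "('a::euclidean_space \<Rightarrow> real) \<Rightarrow> 'a \<Rightarrow> 'a set" where
  "clarke_grad \<phi> x = convex hull
     {v. \<exists>s g. s \<longlonglongrightarrow> x \<and> (\<forall>i. (\<phi> has_derivative (\<lambda>h. g i \<bullet> h)) (at (s i)))
               \<and> g \<longlonglongrightarrow> v}"

definition Delta :: "'a::real_normed_vector set \<Rightarrow> real" where
  "Delta B = Inf (norm ` B)"

definition compl_set :: "'a::topological_space set \<Rightarrow> 'a set" where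
  "compl_set A = closure (- A)"

definition reach :: "'a::euclidean_space set \<Rightarrow> ereal" where
  "reach A = Sup (ereal ` {t. t \<ge> 0 \<and>
      (\<forall>x. infdist x A < t \<longrightarrow> (\<exists>!a. a \<in> A \<and> dist x a = infdist x A))})"

definition reach_mu :: "real \<Rightarrow> 'a::euclidean_space set \<Rightarrow> ereal" where
  "reach_mu \<mu> A = Sup (ereal ` {s. \<forall>x. 0 < infdist x A \<and> infdist x A \<le> s
      \<longrightarrow> Delta (clarke_grad (\<lambda>y. infdist y A) x) \<ge> \<mu>})"

definition complementary_regular :: "'a::euclidean_space set \<Rightarrow> bool" where
  "complementary_regular X \<longleftrightarrow> compact X \<and> closure (interior X) = X
     \<and> (\<exists>\<mu>. 0 < \<mu> \<and> \<mu> \<le> 1 \<and> reach_mu \<mu> X > 0)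
     \<and> reach (compl_set X) > 0"

definition tan_cone :: "'a::euclidean_space set \<Rightarrow> 'a \<Rightarrow> 'a set" where
  "tan_cone A x = cone hull
     {u. \<exists>s. (\<forall>n. s n \<in> A - {x}) \<and> s \<longlonglongrightarrow> x
            \<and> (\<lambda>n. (s n - x) /\<^sub>R norm (s n - x)) \<longlonglongrightarrow> u}"

definition polar_cone :: "'a::euclidean_space set \<Rightarrow> 'a set" where
  "polar_cone B = {u. \<forall>b\<in>B. u \<bullet> b \<le> 0}"

definition nor_cone :: "'a::euclidean_space set \<Rightarrow> 'a \<Rightarrow> 'a set" where
  "nor_cone A x = polar_cone (tan_cone A x)"

definition nor_cr :: "'a::euclidean_space set \<Rightarrow> 'a \<Rightarrow> 'a set" where
  "nor_cr X x = (if x \<in> interior X then {0} else uminus ` nor_cone (compl_set X) x)"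

definition critical_point :: "('a::euclidean_space \<Rightarrow> real) \<Rightarrow> 'a set \<Rightarrow> 'a \<Rightarrow> bool" where
  "critical_point f X x \<longleftrightarrow> x \<in> X \<and>
     (\<exists>v. (GDERIV f x :> v) \<and> v \<in> uminus ` nor_cr X x)"

definition regular_value :: "('a::euclidean_space \<Rightarrow> real) \<Rightarrow> 'a set \<Rightarrow> real \<Rightarrow> bool" where
  "regular_value f X t \<longleftrightarrow> \<not> (\<exists>x \<in> X. f x = t \<and> critical_point f X x)"

definition C2 :: "('a::euclidean_space \<Rightarrow> real) \<Rightarrow> bool" where
  "C2 f \<longleftrightarrow> (\<exists>g H. (\<forall>x. GDERIV f x :> g x) \<and>
      (\<forall>x. (g has_derivative blinfun_apply (H x)) (at x)) \<and> continuous_on UNIV H)"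

end

theory Submission
  imports Defs
begin

text \<open>Let \<open>C\<close> be the closed complement of \<open>X\<close>, of reach greater than \<open>t\<close>. Every boundary point of \<open>X\<close>
  is touched by a ball of radius \<open>t\<close> inside \<open>X\<close>; the inner normals \<open>n\<close> given by these balls depend
  upper semicontinuously on the point. The bound on the Clarke gradients of the distance to \<open>X\<close>
  produces large balls in \<open>C\<close> close to each boundary point, so the inner normals at a point lie in an
  open half-space. Together with regularity this yields a vector \<open>w\<close> along which \<open>f\<close> decreases and
  with \<open>n \<bullet> w > 0\<close> for all inner normals \<open>n\<close>; both properties persist nearby and are convex in \<open>w\<close>,
  so a partition of unity gives a continuous field \<open>W\<close> on \<open>X \<inter> f -` {a..b}\<close>. No flow is needed:
  short straight segments \<open>x + s W x\<close> stay in \<open>X\<close>, and finitely many such pushes, each stopped at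
  the level \<open>a\<close>, compose to the retraction.\<close>

section \<open>Projection and interior balls for sets of positive reach\<close>

lemma dist_closest_point:
  assumes "closed S" "S \<noteq> {}"
  shows "dist x (closest_point S x) = infdist x S"
proof (rule antisym)
  show "dist x (closest_point S x) \<le> infdist x S"
    using assms closest_point_le unfolding infdist_notempty[OF assms(2)]
    by (intro cINF_greatest) auto
  show "infdist x S \<le> dist x (closest_point S x)"
    using assms by (intro infdist_le closest_point_in_set)
qed

text \<open>By compactness, points of \<open>S\<close> at distance at least \<open>e\<close> from
  the projection of \<open>x\<close> are farther from \<open>x\<close> by a positive gap; moving
  \<open>x\<close> by less than half the gap cannot make them nearest.\<close>

lemma continuous_on_closest_point_if_unique:
  fixes S :: "'a::euclidean_space set"
  assumes S: "closed S" "S \<noteq> {}"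
    and uniq: "\<And>x. x \<in> U \<Longrightarrow> \<exists>!a. a \<in> S \<and> dist x a = infdist x S"
  shows "continuous_on U (closest_point S)"
  unfolding continuous_on_iff
proof (intro ballI allI impI)
  fix x and e :: real
  assume x: "x \<in> U" and e: "0 < e"
  define K where "K = S \<inter> cball x (infdist x S + 1) - ball (closest_point S x) e"
  have K: "compact K"
    unfolding K_def using S by (intro compact_diff closed_Int_compact) auto
  have far: "infdist x S < dist x a" if "a \<in> K" for a
  proof -
    have "a \<in> S" "a \<noteq> closest_point S x"
      using that e by (auto simp: K_def)
    moreover have "infdist x S \<le> dist x a"
      using \<open>a \<in> S\<close> by (rule infdist_le)
    ultimately show ?thesis
      using uniq[OF x] dist_closest_point[OF S, of x] closest_point_in_set[OF S, of x]
      by (metis order_le_less)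
  qed
  \<comment> \<open>The cap \<open>infdist x S + 1\<close> keeps every point of \<open>S\<close>
    closer than \<open>m\<close> inside the bounded region defining \<open>K\<close>, and serves as
    \<open>m\<close> when \<open>K\<close> is empty.\<close>
  obtain m where m: "infdist x S < m" "m \<le> infdist x S + 1" "\<And>a. a \<in> K \<Longrightarrow> m \<le> dist x a"
  proof (cases "K = {}")
    case True
    then show ?thesis using that[of "infdist x S + 1"] by auto
  next
    case False
    then obtain b where b: "b \<in> K" "\<And>a. a \<in> K \<Longrightarrow> dist x b \<le> dist x a"
      using distance_attains_inf[OF compact_imp_closed[OF K]] by metis
    then show ?thesis
      using far[OF b(1)] that[of "min (dist x b) (infdist x S + 1)"] by force
  qed
  show "\<exists>d>0. \<forall>y\<in>U. dist y x < d \<longrightarrow> dist (closest_point S y) (closest_point S x) < e"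
  proof (intro exI[of _ "(m - infdist x S) / 2"] conjI ballI impI)
    fix y
    assume y: "dist y x < (m - infdist x S) / 2"
    let ?p = "closest_point S y"
    have "dist x ?p \<le> dist y x + dist y ?p"
      by (metis dist_commute dist_triangle)
    moreover have "dist y ?p \<le> infdist x S + dist y x"
      using dist_closest_point[OF S] infdist_triangle by metis
    ultimately have "dist x ?p < m"
      using y by (simp add: field_simps)
    then have "?p \<notin> K" "?p \<in> S \<inter> cball x (infdist x S + 1)"
      using m closest_point_in_set[OF S, of y] by force+
    then show "dist ?p (closest_point S x) < e"
      by (auto simp: K_def dist_commute)
  qed (use m in auto)
qed

lemma infdist_along_segment:
  fixes p n :: "'a::real_normed_vector"
  assumes "p \<in> S" "norm n = 1" "infdist (p + d *\<^sub>R n) S = d" "0 \<le> s" "s \<le> d"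
  shows "infdist (p + s *\<^sub>R n) S = s"
proof (rule antisym)
  show "infdist (p + s *\<^sub>R n) S \<le> s"
    using infdist_le[OF assms(1), of "p + s *\<^sub>R n"] assms by (simp add: dist_norm)
  have "dist (p + d *\<^sub>R n) (p + s *\<^sub>R n) = d - s"
    using assms by (simp add: dist_norm flip: scaleR_left_diff_distrib)
  then show "s \<le> infdist (p + s *\<^sub>R n) S"
    using infdist_triangle[of "p + d *\<^sub>R n" S "p + s *\<^sub>R n"] assms by linarith
qed

text \<open>Going beyond the largest good parameter, Brouwer's theorem produces a point \<open>y\<close> for which
  \<open>x0\<close> lies between \<open>y\<close> and its projection; uniqueness at \<open>x0\<close> then identifies that projection.\<close>

lemma infdist_along_normal_if_unique:
  fixes S :: "'a::euclidean_space set"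
  assumes S: "closed S" "S \<noteq> {}"
    and uniq: "\<And>x. infdist x S < r \<Longrightarrow> \<exists>!a. a \<in> S \<and> dist x a = infdist x S"
    and p: "p \<in> S" and n: "norm n = 1"
    and d: "0 < d" "d < r" "infdist (p + d *\<^sub>R n) S = d"
    and t: "0 \<le> t" "t < r"
  shows "infdist (p + t *\<^sub>R n) S = t"
proof (cases "t \<le> d")
  case True
  then show ?thesis using infdist_along_segment[OF p n d(3)] t by blast
next
  case False
  \<comment> \<open>Parameters at which the distance is still exact; the claim is that the largest
    one, \<open>T\<close>, equals \<open>t\<close>.\<close>
  define E where "E = {0..t} \<inter> {s. infdist (p + s *\<^sub>R n) S = s}"
  have "compact E"
    unfolding E_def by (intro compact_Int_closed closed_Collect_eq continuous_intros compact_Icc)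
  moreover have dE: "d \<in> E" using d False by (auto simp: E_def)
  ultimately obtain T where T: "T \<in> E" "\<And>s. s \<in> E \<Longrightarrow> s \<le> T"
    using compact_attains_sup[of E] by auto
  have "T = t"
  proof (rule ccontr)
    assume "T \<noteq> t"
    then have Tt: "T < t" and dT: "infdist (p + T *\<^sub>R n) S = T"
      using T(1) by (auto simp: E_def)
    have "d \<le> T" "0 < T" using T(2)[OF dE] d by auto
    note Tt = Tt this
    define x0 where "x0 = p + T *\<^sub>R n"
    \<comment> \<open>Since \<open>e \<le> t - T\<close>, the ball of radius \<open>e\<close> about
      \<open>x0\<close> stays where nearest points are unique, and \<open>T + e\<close> is still a
      parameter in \<open>{0..t}\<close>.\<close>
    define e where "e = min (T / 2) (t - T)"
    have e: "0 < e" "e \<le> t - T" using Tt by (auto simp: e_def)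
    have near: "infdist y S < r" if "y \<in> cball x0 e" for y
      using infdist_triangle[of y S x0] dT that e t by (auto simp: x0_def dist_commute)
    have "x0 \<notin> S" using dT Tt by (auto simp: x0_def)
    then have ne: "x0 \<noteq> closest_point S y" for y
      using closest_point_in_set[OF S] by metis
    \<comment> \<open>\<open>F y\<close> lies at distance \<open>e\<close> from \<open>x0\<close>,
      opposite to the projection of \<open>y\<close>; for a fixed point, \<open>x0\<close> lies on
      the segment from the projection to \<open>y\<close>.\<close>
    define F where "F y = x0 + (e / norm (x0 - closest_point S y)) *\<^sub>R (x0 - closest_point S y)" for y
    have "continuous_on (cball x0 e) (closest_point S)"
      using near uniq by (intro continuous_on_closest_point_if_unique[OF S]) auto
    then have "continuous_on (cball x0 e) F"
      unfolding F_def using ne by (intro continuous_intros) auto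
    moreover have "F \<in> cball x0 e \<rightarrow> cball x0 e"
      using e ne by (auto simp: F_def dist_norm)
    ultimately obtain y where y: "y \<in> cball x0 e" "F y = y"
      using brouwer_ball[OF e(1)] by metis
    define q where "q = closest_point S y"
    define m where "m = (x0 - q) /\<^sub>R norm (x0 - q)"
    have q: "q \<in> S" "q \<noteq> x0" and m: "norm m = 1" "x0 = q + norm (x0 - q) *\<^sub>R m"
      using ne[of y] closest_point_in_set[OF S] by (auto simp: q_def m_def)
    have y_eq: "y = x0 + e *\<^sub>R m"
      using y(2) by (auto simp: F_def q_def m_def divide_inverse)
    have "y - q = (norm (x0 - q) + e) *\<^sub>R m"
      using m(2) y_eq by (simp add: algebra_simps)
    then have ydist: "infdist y S = norm (x0 - q) + e"
      using dist_closest_point[OF S, of y] e m(1) by (simp add: q_def[symmetric] dist_norm)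
    have "dist y x0 = e" using y_eq m e by (simp add: dist_norm)
    \<comment> \<open>The distance is 1-Lipschitz, so it drops by at most \<open>e\<close> from
      \<open>y\<close> to \<open>x0\<close>; hence \<open>q\<close> is nearest to \<open>x0\<close>
      as well.\<close>
    then have "norm (x0 - q) \<le> infdist x0 S"
      using infdist_triangle[of y S x0] ydist by linarith
    then have "dist x0 q = infdist x0 S"
      using infdist_le[OF q(1), of x0] by (simp add: dist_norm)
    moreover have "dist x0 p = infdist x0 S"
      using dT n Tt by (simp add: x0_def dist_norm)
    ultimately have "q = p"
      using uniq[of x0] near[of x0] e q p by auto
    then have "m = n"
      using n Tt by (simp add: m_def x0_def)
    then have "y = p + (T + e) *\<^sub>R n" "infdist y S = T + e"
      using y_eq ydist n Tt \<open>q = p\<close> by (auto simp: x0_def algebra_simps)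
    then have "T + e \<in> E"
      using e Tt by (auto simp: E_def)
    then show False using T(2) e by force
  qed
  then show ?thesis using T(1) by (simp add: E_def)
qed

text \<open>With \<open>C\<close> the closed complement of \<open>X\<close>, these are the
  directions of balls in the interior of \<open>X\<close> touching \<open>y\<close>: proximal
  normals of \<open>C\<close> at one fixed radius. Fixing the radius makes them stable under
  limits.\<close>

definition inner_normals :: "real \<Rightarrow> 'a::euclidean_space set \<Rightarrow> 'a \<Rightarrow> 'a set" where
  "inner_normals t C y = {n. norm n = 1 \<and> ball (y + t *\<^sub>R n) t \<inter> C = {}}"

text \<open>The balls are open: a point of the limit ball lies in the \<open>k\<close>-th ball for
  some \<open>k\<close>, and that ball misses \<open>C\<close>.\<close>

lemma inner_normals_closed_graph:
  assumes n: "\<And>k::nat. n k \<in> inner_normals t C (y k)"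
    and lim: "y \<longlonglongrightarrow> y0" "n \<longlonglongrightarrow> n0"
  shows "n0 \<in> inner_normals t C y0"
proof -
  have "(\<lambda>k. norm (n k)) \<longlonglongrightarrow> norm n0"
    using lim by (intro tendsto_intros)
  moreover have "norm (n k) = 1" for k using n[of k] by (simp add: inner_normals_def)
  ultimately have "norm n0 = 1"
    by (simp add: LIMSEQ_const_iff)
  moreover have "q \<notin> C" if "q \<in> ball (y0 + t *\<^sub>R n0) t" for q
  proof -
    have "(\<lambda>k. dist (y k + t *\<^sub>R n k) q) \<longlonglongrightarrow> dist (y0 + t *\<^sub>R n0) q"
      using lim by (intro tendsto_intros)
    then have "\<forall>\<^sub>F k in sequentially. dist (y k + t *\<^sub>R n k) q < t"
      using that order_tendstoD(2) by (metis mem_ball)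
    then obtain k where "q \<in> ball (y k + t *\<^sub>R n k) t"
      by (auto simp: eventually_sequentially)
    then show ?thesis using n[of k] by (auto simp: inner_normals_def)
  qed
  ultimately show ?thesis by (auto simp: inner_normals_def)
qed

text \<open>Compactness of the unit sphere turns the closed graph into upper semicontinuity.\<close>

lemma inner_normals_convergent_subseq:
  fixes n :: "nat \<Rightarrow> 'a::euclidean_space"
  assumes n: "\<And>k. n k \<in> inner_normals t C (y k)" and y: "y \<longlonglongrightarrow> y0"
  obtains n0 and \<rho> :: "nat \<Rightarrow> nat"
  where "n0 \<in> inner_normals t C y0" "strict_mono \<rho>" "(n \<circ> \<rho>) \<longlonglongrightarrow> n0"
proof -
  have "\<forall>k. n k \<in> sphere 0 1" using n by (auto simp: inner_normals_def)
  then obtain n0 \<rho> where \<rho>: "strict_mono \<rho>" "(n \<circ> \<rho>) \<longlonglongrightarrow> n0"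
    using compact_sphere[of "0::'a" 1] unfolding compact_def by meson
  moreover have "(y \<circ> \<rho>) \<longlonglongrightarrow> y0"
    using y \<rho>(1) by (rule LIMSEQ_subseq_LIMSEQ)
  ultimately have "n0 \<in> inner_normals t C y0"
    using n inner_normals_closed_graph[of "n \<circ> \<rho>" t C "y \<circ> \<rho>"] by simp
  with \<rho> that show ?thesis by blast
qed

text \<open>Approach \<open>y\<close> from outside \<open>C\<close> and project onto
  \<open>C\<close>. The direction from each projection back to its point extends to a ball of full
  radius \<open>t\<close>, and a limit of these directions is a normal at \<open>y\<close>.\<close>

lemma inner_normals_nonempty:
  fixes C :: "'a::euclidean_space set"
  assumes C: "closed C"
    and uniq: "\<And>x. infdist x C < r \<Longrightarrow> \<exists>!a. a \<in> C \<and> dist x a = infdist x C"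
    and t: "0 < t" "t < r"
    and y: "y \<in> C" "y \<in> closure (- C)"
  shows "inner_normals t C y \<noteq> {}"
proof -
  have ne: "C \<noteq> {}" using y by auto
  obtain q where q: "\<And>k. q k \<in> - C" and qlim: "q \<longlonglongrightarrow> y"
    using y(2) unfolding closure_sequential by auto
  have "(\<lambda>k. dist (q k) y) \<longlonglongrightarrow> dist y y"
    using qlim by (intro tendsto_intros)
  then have "\<forall>\<^sub>F k in sequentially. dist (q k) y < r"
    by (rule order_tendstoD(2)) (use t in auto)
  then obtain N where N: "\<And>k. k \<ge> N \<Longrightarrow> dist (q k) y < r"
    by (auto simp: eventually_sequentially)
  define q' where "q' k = q (k + N)" for k
  have q': "q' k \<notin> C" "dist (q' k) y < r" for k
    using q N by (auto simp: q'_def)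
  have lim: "q' \<longlonglongrightarrow> y"
    using LIMSEQ_ignore_initial_segment[OF qlim, of N] by (simp add: q'_def[abs_def])
  define p where "p k = closest_point C (q' k)" for k
  define d where "d k = dist (q' k) (p k)" for k
  define n where "n k = (q' k - p k) /\<^sub>R d k" for k
  have p: "p k \<in> C" "p k \<noteq> q' k" and d: "infdist (q' k) C = d k" for k
    using closest_point_in_set[OF C ne, of "q' k"] q'(1)[of k] dist_closest_point[OF C ne, of "q' k"]
    by (auto simp: p_def d_def)
  have dpos: "0 < d k" "d k < r" "d k \<le> dist (q' k) y" for k
    using p(2)[of k] d[of k] infdist_le[OF y(1), of "q' k"] q'(2)[of k] by (auto simp: d_def)
  have n: "norm (n k) = 1" "q' k = p k + d k *\<^sub>R n k" for k
    using p(2)[of k] by (auto simp: n_def d_def dist_norm)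
  have inn: "n k \<in> inner_normals t C (p k)" for k
  proof -
    have "infdist (p k + t *\<^sub>R n k) C = t"
      by (rule infdist_along_normal_if_unique[OF C ne uniq p(1) n(1), where d = "d k"])
        (use dpos d n t in auto)
    then show ?thesis
      using n(1) infdist_le[of _ C "p k + t *\<^sub>R n k"]
      by (force simp: inner_normals_def)
  qed
  \<comment> \<open>As \<open>y\<close> itself is in \<open>C\<close>, the projection of
    \<open>q' k\<close> is no farther from it than \<open>y\<close>; so the projections converge to
    \<open>y\<close> too.\<close>
  have "(\<lambda>k. norm (p k - q' k)) \<longlonglongrightarrow> 0"
  proof (rule Lim_null_comparison[OF always_eventually])
    show "(\<lambda>k. dist (q' k) y) \<longlonglongrightarrow> 0"
      using lim tendsto_dist_iff[of q' y] by simp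
    show "\<forall>k. norm (norm (p k - q' k)) \<le> dist (q' k) y"
      using dpos(3) by (simp add: d_def dist_norm norm_minus_commute)
  qed
  then have "(\<lambda>k. (p k - q' k) + q' k) \<longlonglongrightarrow> 0 + y"
    using lim by (intro tendsto_add) (simp_all add: tendsto_norm_zero_iff)
  then have "p \<longlonglongrightarrow> y" by simp
  then show ?thesis
    using inner_normals_convergent_subseq[of n t C p y] inn by blast
qed

section \<open>Clarke gradients of the distance function\<close>

text \<open>Serves to differentiate the distance function where it is known only through two
  differentiable bounds.\<close>

lemma has_derivative_sandwich:
  fixes f :: "'a::real_normed_vector \<Rightarrow> real"
  assumes U: "(U has_derivative D) (at x)" and L: "(L has_derivative D) (at x)"
    and le: "\<And>y. L y \<le> f y" "\<And>y. f y \<le> U y" and eq: "L x = f x" "U x = f x"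
  shows "(f has_derivative D) (at x)"
  unfolding has_derivative_at_alt
proof (intro conjI allI impI)
  show "bounded_linear D" using U by (rule has_derivative_bounded_linear)
  fix e :: real assume "e > 0"
  with U L obtain d1 d2 where d: "d1 > 0" "d2 > 0"
    "\<And>y. norm (y - x) < d1 \<Longrightarrow> norm (U y - U x - D (y - x)) \<le> e * norm (y - x)"
    "\<And>y. norm (y - x) < d2 \<Longrightarrow> norm (L y - L x - D (y - x)) \<le> e * norm (y - x)"
    unfolding has_derivative_at_alt by metis
  show "\<exists>d>0. \<forall>y. norm (y - x) < d \<longrightarrow> norm (f y - f x - D (y - x)) \<le> e * norm (y - x)"
  proof (intro exI[of _ "min d1 d2"] conjI allI impI)
    fix y assume "norm (y - x) < min d1 d2"
    then show "norm (f y - f x - D (y - x)) \<le> e * norm (y - x)"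
      using d(3,4)[of y] le[of y] eq by simp
  qed (use d in auto)
qed

text \<open>For \<open>z\<close> outside \<open>S\<close> these unit vectors are limits of gradients
  of the distance, hence members of its Clarke gradient.\<close>

definition nearest_directions :: "'a::euclidean_space set \<Rightarrow> 'a \<Rightarrow> 'a set" where
  "nearest_directions S z = (\<lambda>p. (z - p) /\<^sub>R norm (z - p)) ` {p \<in> S. dist z p = infdist z S}"

text \<open>Strictly between \<open>p\<close> and \<open>z\<close> the distance to \<open>S\<close>
  is squeezed between the distance to \<open>p\<close> and
  \<open>infdist z S - norm (z - y)\<close>; both bounds agree there in value and gradient.\<close>

lemma has_derivative_infdist_towards_nearest:
  fixes S :: "'a::euclidean_space set"
  assumes p: "p \<in> S" "dist z p = infdist z S" "z \<noteq> p" and l: "0 < l" "l < 1"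
  shows "((\<lambda>y. infdist y S) has_derivative (\<lambda>h. ((z - p) /\<^sub>R norm (z - p)) \<bullet> h))
           (at (p + l *\<^sub>R (z - p)))"
proof -
  let ?x = "p + l *\<^sub>R (z - p)"
  have xp: "?x - p = l *\<^sub>R (z - p)" and zx: "z - ?x = (1 - l) *\<^sub>R (z - p)"
    by (auto simp: algebra_simps)
  have nxp: "norm (?x - p) = l * norm (z - p)" and nzx: "norm (z - ?x) = (1 - l) * norm (z - p)"
    unfolding xp zx using l by auto
  have sgn: "sgn (?x - p) = (z - p) /\<^sub>R norm (z - p)" "sgn (z - ?x) = (z - p) /\<^sub>R norm (z - p)"
    unfolding xp zx using l p by (auto simp: sgn_div_norm)
  show ?thesis
  proof (rule has_derivative_sandwich)
    have ne: "?x - p \<noteq> 0" "z - ?x \<noteq> 0"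
      unfolding xp zx using l p by auto
    have "((\<lambda>y. norm (y - p)) has_derivative (\<lambda>h. h \<bullet> sgn (?x - p))) (at ?x)"
      by (rule has_derivative_compose[where f = "\<lambda>y. y - p" and g = norm, OF _ has_derivative_norm[OF ne(1)]])
        (auto intro!: derivative_eq_intros)
    then show "((\<lambda>y. norm (y - p)) has_derivative (\<lambda>h. ((z - p) /\<^sub>R norm (z - p)) \<bullet> h)) (at ?x)"
      unfolding sgn by (simp only: inner_commute)
    have "((\<lambda>y. norm (z - y)) has_derivative (\<lambda>h. (- h) \<bullet> sgn (z - ?x))) (at ?x)"
      by (rule has_derivative_compose[where f = "\<lambda>y. z - y" and g = norm, OF _ has_derivative_norm[OF ne(2)]])
        (auto intro!: derivative_eq_intros)
    then have "((\<lambda>y. infdist z S - norm (z - y)) has_derivative (\<lambda>h. 0 - (- h) \<bullet> sgn (z - ?x))) (at ?x)"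
      by (intro has_derivative_diff has_derivative_const)
    then show "((\<lambda>y. infdist z S - norm (z - y)) has_derivative (\<lambda>h. ((z - p) /\<^sub>R norm (z - p)) \<bullet> h)) (at ?x)"
      unfolding sgn by (simp add: inner_commute)
    show "infdist y S \<le> norm (y - p)" for y
      using infdist_le[OF p(1), of y] by (simp add: dist_norm)
    show "infdist z S - norm (z - y) \<le> infdist y S" for y
      using infdist_triangle[of z S y] by (simp add: dist_norm)
    then have "infdist z S - norm (z - ?x) \<le> infdist ?x S" .
    moreover have "infdist ?x S \<le> norm (?x - p)"
      using infdist_le[OF p(1), of ?x] by (simp add: dist_norm)
    moreover have "infdist z S - norm (z - ?x) = norm (?x - p)"
      unfolding nxp nzx p(2)[symmetric] dist_norm by (simp add: algebra_simps)
    ultimately show "infdist z S - norm (z - ?x) = infdist ?x S" "norm (?x - p) = infdist ?x S"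
      by auto
  qed
qed

lemma hull_nearest_directions_subset_clarke_grad:
  assumes "z \<notin> S"
  shows "convex hull nearest_directions S z \<subseteq> clarke_grad (\<lambda>y. infdist y S) z"
  unfolding clarke_grad_def
proof (rule hull_mono, rule subsetI)
  fix v assume "v \<in> nearest_directions S z"
  then obtain p where p: "p \<in> S" "dist z p = infdist z S" "v = (z - p) /\<^sub>R norm (z - p)"
    by (auto simp: nearest_directions_def)
  \<comment> \<open>Along the segment from \<open>p\<close> to \<open>z\<close> the gradient is
    constantly \<open>v\<close>. The shift by 2 keeps the factor strictly between 0 and 1 already
    for \<open>i = 0\<close>.\<close>
  define s where "s i = p + (1 - 1 / real (i + 2)) *\<^sub>R (z - p)" for i
  have "(\<lambda>i. 1 / real (i + 2)) \<longlonglongrightarrow> 0"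
    using LIMSEQ_ignore_initial_segment[OF lim_1_over_n, of 2] by simp
  then have "s \<longlonglongrightarrow> p + (1 - 0) *\<^sub>R (z - p)"
    unfolding s_def by (intro tendsto_intros)
  moreover have "((\<lambda>y. infdist y S) has_derivative (\<lambda>h. v \<bullet> h)) (at (s i))" for i
    unfolding s_def p(3) using assms p
    by (intro has_derivative_infdist_towards_nearest) auto
  ultimately show "v \<in> {v. \<exists>s g. s \<longlonglongrightarrow> z
      \<and> (\<forall>i. ((\<lambda>y. infdist y S) has_derivative (\<lambda>h. g i \<bullet> h)) (at (s i))) \<and> g \<longlonglongrightarrow> v}"
    by (intro CollectI exI[of _ s] exI[of _ "\<lambda>_. v"]) simp
qed

lemma compact_nearest_directions:
  assumes "closed S" "z \<notin> S"
  shows "compact (nearest_directions S z)"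
proof -
  have "{p \<in> S. dist z p = infdist z S} = S \<inter> sphere z (infdist z S)" by auto
  then have "compact {p \<in> S. dist z p = infdist z S}"
    using assms(1) closed_Int_compact[OF _ compact_sphere] by simp
  moreover have "continuous_on {p \<in> S. dist z p = infdist z S} (\<lambda>p. (z - p) /\<^sub>R norm (z - p))"
    using assms(2) by (intro continuous_on_scaleR continuous_on_inverse continuous_on_norm
        continuous_on_diff continuous_on_const continuous_on_id) auto
  ultimately show ?thesis
    unfolding nearest_directions_def by (rule compact_continuous_image[rotated])
qed

text \<open>Let \<open>v\<close> be the element of least norm in the hull. Moving \<open>z\<close>
  along \<open>v\<close> raises the distance at a rate of at least \<open>norm v\<close>, so the
  slope bound forces \<open>norm v \<le> m\<close>.\<close>

lemma small_slope_imp_small_nearest_hull: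
  fixes S :: "'a::euclidean_space set"
  assumes S: "closed S" "S \<noteq> {}" "z \<notin> S" and d: "0 < d" and m: "0 \<le> m"
    and slope: "\<And>h. norm h < d \<Longrightarrow> infdist (z + h) S \<le> infdist z S + m * norm h"
  shows "\<exists>v \<in> convex hull nearest_directions S z. norm v \<le> m"
proof -
  let ?K = "convex hull nearest_directions S z"
  have K: "closed ?K" "convex ?K"
    using compact_convex_hull[OF compact_nearest_directions[OF S(1,3)]] compact_imp_closed by auto
  have "?K \<noteq> {}"
    using closest_point_in_set[OF S(1,2), of z] dist_closest_point[OF S(1,2), of z]
    by (auto simp: nearest_directions_def)
  then obtain v where v: "v \<in> ?K" "\<And>w. w \<in> ?K \<Longrightarrow> dist 0 v \<le> dist 0 w"
    using distance_attains_inf[OF K(1)] by metis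
  \<comment> \<open>Variational inequality for \<open>v\<close> as the projection of the origin onto
    the hull.\<close>
  have dot: "v \<bullet> v \<le> u \<bullet> v" if "u \<in> nearest_directions S z" for u
    using any_closest_point_dot[OF K(2,1) v(1), of u 0] that v(2) hull_inc[OF that]
    by (auto simp: inner_diff_right inner_commute)
  have "norm v \<le> m"
  proof (rule ccontr)
    assume "\<not> norm v \<le> m"
    then have nv: "m < norm v" "v \<noteq> 0" using m by auto
    \<comment> \<open>Steps along \<open>v\<close> tending to 0; the factor 2 keeps even the first
      one shorter than \<open>d\<close>.\<close>
    define h where "h k = (d / (2 * norm v * real (Suc k))) *\<^sub>R v" for k
    have hd: "norm (h k) = d / (2 * real (Suc k))" for k
      using nv d by (simp add: h_def)
    have hlt: "norm (h k) < d" for k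
    proof -
      have "d * 1 < d * (2 * real (Suc k))" using d by (intro mult_strict_left_mono) auto
      then show ?thesis unfolding hd by (simp add: field_simps)
    qed
    have "(\<lambda>k. d / 2 * (1 / real (Suc k))) \<longlonglongrightarrow> d / 2 * 0"
      by (intro tendsto_intros LIMSEQ_Suc[OF lim_1_over_n])
    then have h0: "h \<longlonglongrightarrow> 0"
      by (subst tendsto_norm_zero_iff[symmetric]) (simp add: hd)
    define p where "p k = closest_point S (z + h k)" for k
    have p: "p k \<in> S" "dist (z + h k) (p k) = infdist (z + h k) S" for k
      using closest_point_in_set[OF S(1,2)] dist_closest_point[OF S(1,2)] by (auto simp: p_def)
    have inf_le: "infdist (z + h k) S \<le> infdist z S + norm (h k)" for k
      using infdist_triangle[of "z + h k" S z] by (simp add: dist_norm)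
    have "p k \<in> S \<inter> cball z (infdist z S + 2 * d)" for k
    proof -
      have "dist z (p k) \<le> norm (h k) + dist (z + h k) (p k)"
        using dist_triangle[of z "p k" "z + h k"] by (simp add: dist_norm)
      then show ?thesis using p(1)[of k] p(2)[of k] inf_le[of k] hlt[of k] by auto
    qed
    moreover have "compact (S \<inter> cball z (infdist z S + 2 * d))"
      using S by (intro closed_Int_compact) auto
    ultimately obtain q \<rho> where q: "q \<in> S" "strict_mono (\<rho> :: nat \<Rightarrow> nat)" "(p \<circ> \<rho>) \<longlonglongrightarrow> q"
      unfolding compact_def by blast
    have h\<rho>: "(\<lambda>k. h (\<rho> k)) \<longlonglongrightarrow> 0" and p\<rho>: "(\<lambda>k. p (\<rho> k)) \<longlonglongrightarrow> q"
      using LIMSEQ_subseq_LIMSEQ[OF h0 q(2)] q(3) by (auto simp: o_def)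
    have "(\<lambda>k. dist (z + h (\<rho> k)) (p (\<rho> k))) \<longlonglongrightarrow> dist (z + 0) q"
      by (intro tendsto_intros h\<rho> p\<rho>)
    moreover have "(\<lambda>k. infdist (z + h (\<rho> k)) S) \<longlonglongrightarrow> infdist (z + 0) S"
      by (intro tendsto_intros h\<rho>)
    ultimately have "dist z q = infdist z S"
      using LIMSEQ_unique p(2) by auto
    with q(1) have u: "(z - q) /\<^sub>R norm (z - q) \<in> nearest_directions S z"
      by (auto simp: nearest_directions_def)
    define u where "u k = (z - p k) /\<^sub>R norm (z - p k)" for k
    have "u k \<bullet> v \<le> m * norm v" for k
    proof -
      have zp: "z \<noteq> p k" using p S by auto
      have nu: "norm (u k) = 1" using zp by (simp add: u_def)
      have "u k \<bullet> (z - p k) = norm (z - p k)"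
        using zp by (simp add: u_def power2_norm_eq_inner[symmetric] power2_eq_square)
      \<comment> \<open>Cauchy-Schwarz and the slope bound limit this sum by
        \<open>infdist z S + m * norm (h k)\<close>; as
        \<open>infdist z S \<le> norm (z - p k)\<close>, only
        \<open>u k \<bullet> h k \<le> m * norm (h k)\<close> remains.\<close>
      then have "norm (z - p k) + u k \<bullet> h k = u k \<bullet> (z + h k - p k)"
        by (simp add: inner_add_right inner_diff_right)
      also have "\<dots> \<le> norm (z + h k - p k)"
        using norm_cauchy_schwarz[of "u k" "z + h k - p k"] nu by simp
      also have "\<dots> \<le> infdist z S + m * norm (h k)"
        using p(2)[of k] slope[OF hlt[of k]] by (simp add: dist_norm)
      finally have "u k \<bullet> h k \<le> m * norm (h k)"
        using infdist_le[OF p(1)[of k], of z] by (simp add: dist_norm)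
      moreover obtain c where "0 < c" "h k = c *\<^sub>R v"
      proof
        show "0 < d / (2 * norm v * real (Suc k))"
          using d nv by (intro divide_pos_pos mult_pos_pos) auto
      qed (simp add: h_def)
      ultimately show ?thesis
        by (simp add: mult.left_commute[of m] mult_le_cancel_left_pos)
    qed
    moreover have "(\<lambda>k. u (\<rho> k) \<bullet> v) \<longlonglongrightarrow> ((z - q) /\<^sub>R norm (z - q)) \<bullet> v"
      unfolding u_def using q(1) S(3) by (intro tendsto_intros p\<rho>) auto
    ultimately have "((z - q) /\<^sub>R norm (z - q)) \<bullet> v \<le> m * norm v"
      by (intro LIMSEQ_le_const2) auto
    with dot[OF u] have "norm v * norm v \<le> m * norm v"
      by (simp add: power2_norm_eq_inner[symmetric] power2_eq_square)
    then show False using nv by simp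
  qed
  with v(1) show ?thesis by blast
qed

text \<open>A maximum of \<open>infdist z S - m * dist z y\<close> inside the ball would carry a Clarke gradient of
  norm at most \<open>m\<close>, so the maximum sits on the sphere.\<close>

lemma steep_infdist_imp_far_point:
  fixes S :: "'a::euclidean_space set"
  assumes S: "closed S"
    and steep: "\<And>z. 0 < infdist z S \<Longrightarrow> infdist z S \<le> \<sigma> \<Longrightarrow> \<mu> \<le> Delta (clarke_grad (\<lambda>y. infdist y S) z)"
    and x: "x \<in> S" "x \<in> closure (- S)" and s: "0 < s" "s \<le> \<sigma>" and m: "0 < m" "m < \<mu>"
  shows "\<exists>z. dist z x = s \<and> m * (s / 2) \<le> infdist z S"
proof -
  have ne: "S \<noteq> {}" using x by auto
  obtain y where y: "y \<notin> S" "dist y x < s / 2"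
    using x(2) s by (metis ComplD closure_approachable half_gt_zero)
  \<comment> \<open>The penalty is centred at a point \<open>y\<close> outside \<open>S\<close>, so
    the maximum of \<open>\<phi>\<close> is positive and \<open>infdist z S > m * dist z y\<close>
    at a maximum point.\<close>
  define \<phi> where "\<phi> z = infdist z S - m * dist z y" for z
  have "continuous_on (cball x s) \<phi>"
    unfolding \<phi>_def by (intro continuous_intros)
  then obtain z where z: "z \<in> cball x s" "\<And>w. w \<in> cball x s \<Longrightarrow> \<phi> w \<le> \<phi> z"
    using continuous_attains_sup[OF compact_cball] s by (metis cball_eq_empty less_le_not_le linorder_not_le)
  have "0 < infdist y S"
    using infdist_pos_not_in_closed[OF S ne y(1)] .
  also have "infdist y S = \<phi> y" by (simp add: \<phi>_def)
  also have "\<phi> y \<le> \<phi> z" using y s by (intro z(2)) (auto simp: dist_commute)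
  finally have pos: "m * dist z y < infdist z S" by (simp add: \<phi>_def)
  then have zpos: "0 < infdist z S"
    using m by (smt (verit) mult_nonneg_nonneg zero_le_dist)
  have "dist z x = s"
  proof (rule ccontr)
    assume "dist z x \<noteq> s"
    then have zs: "dist z x < s" using z(1) by (auto simp: dist_commute)
    have "\<exists>v \<in> convex hull nearest_directions S z. norm v \<le> m"
    proof (rule small_slope_imp_small_nearest_hull[OF S ne])
      show "z \<notin> S" using zpos by auto
      show "0 < s - dist z x" using zs by simp
      fix h :: 'a assume h: "norm h < s - dist z x"
      have "dist x (z + h) \<le> dist z x + norm h"
        using dist_triangle[of x "z + h" z] by (simp add: dist_norm norm_minus_commute)
      then have "\<phi> (z + h) \<le> \<phi> z" using h by (intro z(2)) auto
      moreover have "m * dist (z + h) y \<le> m * (dist z y + norm h)"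
        using m dist_triangle[of "z + h" y z] by (intro mult_left_mono) (auto simp: dist_norm)
      ultimately show "infdist (z + h) S \<le> infdist z S + m * norm h"
        by (simp add: \<phi>_def algebra_simps)
    qed (use m in auto)
    then obtain v where v: "v \<in> clarke_grad (\<lambda>y. infdist y S) z" "norm v \<le> m"
      using hull_nearest_directions_subset_clarke_grad[of z S] zpos by fastforce
    have "Delta (clarke_grad (\<lambda>y. infdist y S) z) \<le> norm v"
      unfolding Delta_def using v(1) by (intro cInf_lower bdd_belowI[of _ 0]) auto
    moreover have "infdist z S \<le> \<sigma>"
      using infdist_le[OF x(1), of z] zs s by simp
    ultimately show False using steep[OF zpos] v(2) m by auto
  qed
  \<comment> \<open>On the sphere, \<open>z\<close> is at least \<open>s / 2\<close> away from
    \<open>y\<close>, because \<open>y\<close> is within \<open>s / 2\<close> of the centre.\<close>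
  moreover have "m * (s / 2) \<le> m * dist z y"
    using m y(2) dist_triangle[of z x y] \<open>dist z x = s\<close> by (intro mult_left_mono) (auto simp: dist_commute)
  ultimately show ?thesis using pos by auto
qed

section \<open>Directions pointing into the set\<close>

lemma reach_pos_imp_unique_nearest:
  assumes "0 < reach A"
  obtains r where "0 < r" "\<And>x. infdist x A < r \<Longrightarrow> \<exists>!a. a \<in> A \<and> dist x a = infdist x A"
  using assms unfolding reach_def less_Sup_iff by auto

lemma reach_mu_pos_imp_steep:
  assumes "0 < reach_mu \<mu> A"
  obtains \<sigma> where "0 < \<sigma>"
    "\<And>x. 0 < infdist x A \<Longrightarrow> infdist x A \<le> \<sigma> \<Longrightarrow> \<mu> \<le> Delta (clarke_grad (\<lambda>y. infdist y A) x)"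
  using assms unfolding reach_mu_def less_Sup_iff by auto

text \<open>Otherwise the point dividing the segment of centres in the ratio of the radii lies in
  both balls.\<close>

lemma dist_ge_if_balls_disjoint:
  fixes c z :: "'a::real_normed_vector"
  assumes "0 < t" "0 < \<rho>" "ball c t \<inter> ball z \<rho> = {}"
  shows "t + \<rho> \<le> dist c z"
proof (rule ccontr)
  assume "\<not> t + \<rho> \<le> dist c z"
  then have D: "norm (z - c) < t + \<rho>" by (simp add: dist_norm norm_minus_commute)
  define w where "w = c + (t / (t + \<rho>)) *\<^sub>R (z - c)"
  have "norm (w - c) = (t / (t + \<rho>)) * norm (z - c)"
    using assms by (simp add: w_def)
  also have "\<dots> < (t / (t + \<rho>)) * (t + \<rho>)"
    using D assms by (intro mult_strict_left_mono) auto
  finally have 1: "w \<in> ball c t"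
    using assms by (simp add: dist_norm norm_minus_commute)
  have "1 - t / (t + \<rho>) = \<rho> / (t + \<rho>)"
    using assms by (simp add: field_simps)
  then have "z - w = (\<rho> / (t + \<rho>)) *\<^sub>R (z - c)"
    unfolding w_def by (metis diff_diff_add scaleR_left_diff_distrib scaleR_one)
  then have "norm (z - w) = (\<rho> / (t + \<rho>)) * norm (z - c)"
    using assms by simp
  also have "\<dots> < (\<rho> / (t + \<rho>)) * (t + \<rho>)"
    using D assms by (intro mult_strict_left_mono) auto
  finally have "w \<in> ball z \<rho>"
    using assms by (simp add: dist_norm)
  with 1 show False using assms by blast
qed

lemma power2_norm_diff_scaleR:
  fixes v n :: "'a::real_inner"
  assumes "norm n = 1"
  shows "(norm (v - t *\<^sub>R n))\<^sup>2 = (norm v)\<^sup>2 - 2 * t * (n \<bullet> v) + t\<^sup>2"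
proof -
  have "n \<bullet> n = 1" using assms by (simp add: norm_eq_1)
  then show ?thesis
    unfolding power2_norm_eq_inner
    by (simp add: inner_diff_left inner_diff_right inner_commute power2_eq_square[of t] algebra_simps)
qed

text \<open>A point of \<open>C\<close> outside the touching ball satisfies
  \<open>2 * t * (n \<bullet> (s - x)) \<le> (norm (s - x))\<^sup>2\<close>; dividing by
  \<open>norm (s - x)\<close> and letting \<open>s\<close> tend to \<open>x\<close> gives the polar
  inequality.\<close>

lemma inner_normals_subset_nor_cone:
  assumes t: "0 < t"
  shows "inner_normals t C x \<subseteq> nor_cone C x"
proof
  fix n assume n: "n \<in> inner_normals t C x"
  have "n \<bullet> u \<le> 0" if s: "\<And>k. s k \<in> C - {x}" "s \<longlonglongrightarrow> x"
    and u: "(\<lambda>k. (s k - x) /\<^sub>R norm (s k - x)) \<longlonglongrightarrow> u" for s u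
  proof (rule LIMSEQ_le)
    show "(\<lambda>k. n \<bullet> ((s k - x) /\<^sub>R norm (s k - x))) \<longlonglongrightarrow> n \<bullet> u"
      by (intro tendsto_intros u)
    have "(\<lambda>k. norm (s k - x) / (2 * t)) \<longlonglongrightarrow> norm (x - x) / (2 * t)"
      using t by (intro tendsto_intros s(2)) auto
    then show "(\<lambda>k. norm (s k - x) / (2 * t)) \<longlonglongrightarrow> 0" by simp
    have "n \<bullet> ((s k - x) /\<^sub>R norm (s k - x)) \<le> norm (s k - x) / (2 * t)" for k
    proof -
      have sx: "0 < norm (s k - x)" using s(1)[of k] by auto
      have "s k \<notin> ball (x + t *\<^sub>R n) t" using n s(1)[of k] by (auto simp: inner_normals_def)
      moreover have "dist (x + t *\<^sub>R n) (s k) = norm ((s k - x) - t *\<^sub>R n)"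
        by (metis dist_commute dist_norm diff_diff_add)
      ultimately have "t\<^sup>2 \<le> (norm ((s k - x) - t *\<^sub>R n))\<^sup>2"
        using t by (intro power_mono) auto
      then have "2 * t * (n \<bullet> (s k - x)) \<le> norm (s k - x) * norm (s k - x)"
        using n by (simp add: power2_norm_diff_scaleR inner_normals_def flip: power2_eq_square)
      then have "2 * t * (n \<bullet> (s k - x)) / norm (s k - x) \<le> norm (s k - x)"
        using sx by (simp add: divide_le_eq)
      then have "2 * t * (n \<bullet> ((s k - x) /\<^sub>R norm (s k - x))) \<le> norm (s k - x)"
        by (simp only: inner_scaleR_right divide_inverse mult.commute mult.left_commute mult.assoc)
      then show ?thesis using t by (simp only: pos_le_divide_eq mult.commute mult.left_commute)
    qed
    then show "\<exists>N. \<forall>k\<ge>N. n \<bullet> ((s k - x) /\<^sub>R norm (s k - x)) \<le> norm (s k - x) / (2 * t)"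
      by blast
  qed
  then show "n \<in> nor_cone C x"
    unfolding nor_cone_def polar_cone_def tan_cone_def cone_hull_expl
    by (fastforce intro: mult_nonneg_nonpos)
qed

text \<open>The complement of \<open>X\<close> contains a ball whose size is comparable to its distance from \<open>x\<close>; every
  interior ball at \<open>x\<close> has to avoid it.\<close>

lemma inner_normals_in_open_halfspace:
  fixes X :: "'a::euclidean_space set"
  assumes X: "closed X" and \<mu>: "0 < \<mu>" and \<sigma>: "0 < \<sigma>"
    and steep: "\<And>z. 0 < infdist z X \<Longrightarrow> infdist z X \<le> \<sigma> \<Longrightarrow> \<mu> \<le> Delta (clarke_grad (\<lambda>y. infdist y X) z)"
    and x: "x \<in> X" "x \<in> closure (- X)" and t: "0 < t"
  obtains h c where "0 < c" "\<And>n. n \<in> inner_normals t (compl_set X) x \<Longrightarrow> n \<bullet> h \<le> - c"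
proof -
  define m where "m = \<mu> / 2"
  \<comment> \<open>The bound \<open>t * m / 2\<close> yields \<open>s * s \<le> t * \<rho>\<close>
    for \<open>\<rho> = m * (s / 2)\<close>, so the quadratic term below absorbs only half of
    \<open>2 * t * \<rho>\<close>.\<close>
  define s where "s = min \<sigma> (t * m / 2)"
  have m: "0 < m" "m < \<mu>" using \<mu> by (auto simp: m_def)
  have s: "0 < s" "s \<le> \<sigma>" "s \<le> t * m / 2" using t m \<sigma> by (auto simp: s_def)
  obtain z where z: "dist z x = s" "m * (s / 2) \<le> infdist z X"
    using steep_infdist_imp_far_point[OF X steep x s(1,2) m] by blast
  define \<rho> where "\<rho> = m * (s / 2)"
  have \<rho>: "0 < \<rho>" using m s by (simp add: \<rho>_def)
  have "ball z \<rho> \<subseteq> - X"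
    using z(2) infdist_le[of _ X z] by (force simp: \<rho>_def)
  then have zC: "ball z \<rho> \<subseteq> compl_set X"
    unfolding compl_set_def using closure_subset by blast
  show thesis
  proof
    show "0 < \<rho> / 2" using \<rho> by simp
    fix n assume n: "n \<in> inner_normals t (compl_set X) x"
    then have "t + \<rho> \<le> dist (x + t *\<^sub>R n) z"
      using zC t \<rho> by (intro dist_ge_if_balls_disjoint) (auto simp: inner_normals_def)
    also have "\<dots> = norm ((z - x) - t *\<^sub>R n)"
      by (metis dist_commute dist_norm diff_diff_add)
    finally have "(t + \<rho>)\<^sup>2 \<le> (norm ((z - x) - t *\<^sub>R n))\<^sup>2"
      using t \<rho> by (intro power_mono) auto
    also have "\<dots> = s\<^sup>2 - 2 * t * (n \<bullet> (z - x)) + t\<^sup>2"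
      using n z(1) by (simp add: power2_norm_diff_scaleR inner_normals_def dist_norm)
    finally have "2 * t * (n \<bullet> (z - x)) \<le> s * s - 2 * t * \<rho>"
      using zero_le_power2[of \<rho>] power2_sum[of t \<rho>] power2_eq_square[of s] by linarith
    moreover have "s * s \<le> t * \<rho>"
      using mult_left_mono[OF s(3), of s] s(1) by (simp add: \<rho>_def algebra_simps)
    ultimately have "(2 * t) * (n \<bullet> (z - x)) \<le> (2 * t) * (- (\<rho> / 2))"
      by (simp add: algebra_simps)
    with t show "n \<bullet> (z - x) \<le> - (\<rho> / 2)"
      by (simp only: mult_le_cancel_left_pos mult_pos_pos zero_less_numeral)
  qed
qed

text \<open>Otherwise normals violating the inequality at points tending to \<open>x\<close> would
  have a limit violating it at \<open>x\<close>.\<close>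

lemma inner_normals_positive_nearby:
  fixes w :: "'a::euclidean_space"
  assumes "\<And>n. n \<in> inner_normals t C x \<Longrightarrow> 0 < n \<bullet> w"
  obtains d where "0 < d" "\<And>y n. dist y x < d \<Longrightarrow> n \<in> inner_normals t C y \<Longrightarrow> 0 < n \<bullet> w"
proof (rule ccontr)
  assume "\<not> thesis"
  with that have "\<exists>y n. dist y x < d \<and> n \<in> inner_normals t C y \<and> n \<bullet> w \<le> 0" if "0 < d" for d
    using \<open>0 < d\<close> by (meson linorder_not_less)
  then have "\<forall>k. \<exists>y n. dist y x < 1 / real (Suc k) \<and> n \<in> inner_normals t C y \<and> n \<bullet> w \<le> 0"
    by simp
  then obtain y n where yn: "\<And>k. dist (y k) x < 1 / real (Suc k)"
      "\<And>k. n k \<in> inner_normals t C (y k)" "\<And>k. n k \<bullet> w \<le> 0"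
    by metis
  have "(\<lambda>k. dist (y k) x) \<longlonglongrightarrow> 0"
  proof (rule Lim_null_comparison[OF always_eventually LIMSEQ_Suc[OF lim_1_over_n]])
    show "\<forall>k. norm (dist (y k) x) \<le> 1 / of_nat (Suc k)"
      using yn(1) by (simp add: less_imp_le del: of_nat_Suc)
  qed
  then have "y \<longlonglongrightarrow> x" using tendsto_dist_iff by blast
  then obtain n0 \<rho> where n0: "n0 \<in> inner_normals t C x" "(n \<circ> \<rho>) \<longlonglongrightarrow> n0"
    using inner_normals_convergent_subseq[of n t C y x] yn(2) by blast
  then have "(\<lambda>k. (n \<circ> \<rho>) k \<bullet> w) \<longlonglongrightarrow> n0 \<bullet> w"
    by (intro tendsto_intros)
  then have "n0 \<bullet> w \<le> 0"
    using yn(3) by (intro LIMSEQ_le_const2) auto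
  then show False using assms[OF n0(1)] by simp
qed

text \<open>Since \<open>v\<close> is not normal, some tangent vector \<open>u\<close> of the
  complement has \<open>v \<bullet> u > 0\<close>. Then \<open>- u\<close> is a descent direction
  and weakly inward; subtracting a small multiple of \<open>h\<close> makes it strictly
  inward.\<close>

lemma descent_direction_into_set:
  fixes X :: "'a::euclidean_space set"
  assumes X: "closed X" and \<mu>: "0 < \<mu>" and \<sigma>: "0 < \<sigma>"
    and steep: "\<And>z. 0 < infdist z X \<Longrightarrow> infdist z X \<le> \<sigma> \<Longrightarrow> \<mu> \<le> Delta (clarke_grad (\<lambda>y. infdist y X) z)"
    and x: "x \<in> X" "x \<in> closure (- X)" and t: "0 < t"
    and v: "v \<notin> nor_cone (compl_set X) x"
  obtains w where "v \<bullet> w < 0" "\<And>n. n \<in> inner_normals t (compl_set X) x \<Longrightarrow> 0 < n \<bullet> w"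
proof -
  obtain u where u: "u \<in> tan_cone (compl_set X) x" "0 < v \<bullet> u"
    using v by (auto simp: nor_cone_def polar_cone_def)
  obtain h c where h: "0 < c" "\<And>n. n \<in> inner_normals t (compl_set X) x \<Longrightarrow> n \<bullet> h \<le> - c"
    using inner_normals_in_open_halfspace[OF X \<mu> \<sigma> steep x t] by metis
  \<comment> \<open>Small enough that the correction \<open>e *\<^sub>R h\<close> changes the
    product with \<open>v\<close> by at most half of \<open>v \<bullet> u\<close>.\<close>
  define e where "e = v \<bullet> u / (2 * (\<bar>v \<bullet> h\<bar> + 1))"
  have e: "0 < e" using u(2) by (simp add: e_def)
  have "e * \<bar>v \<bullet> h\<bar> \<le> e * (\<bar>v \<bullet> h\<bar> + 1)" using e by simp
  also have "\<dots> = v \<bullet> u / 2" by (simp add: e_def divide_simps)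
  also have "\<dots> < v \<bullet> u" using u by simp
  finally have small: "\<bar>e * (v \<bullet> h)\<bar> < v \<bullet> u" using e by (simp add: abs_mult)
  show thesis
  proof
    show "v \<bullet> (- (u + e *\<^sub>R h)) < 0"
      using small unfolding inner_minus_right inner_add_right inner_scaleR_right by linarith
    fix n assume n: "n \<in> inner_normals t (compl_set X) x"
    then have "n \<bullet> u \<le> 0"
      using inner_normals_subset_nor_cone[OF t] u(1) by (fastforce simp: nor_cone_def polar_cone_def)
    moreover have "e * (n \<bullet> h) < 0"
      using h(2)[OF n] h(1) e by (simp add: mult_pos_neg)
    ultimately show "0 < n \<bullet> (- (u + e *\<^sub>R h))"
      unfolding inner_minus_right inner_add_right inner_scaleR_right by linarith
  qed
qed

text \<open>First-exit argument: at the infimum \<open>i\<close> of the exit times the point is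
  still in the closed set \<open>X\<close>, and there the interior or a touching inner ball lets the
  segment continue inside.\<close>

lemma segment_stays_in_set:
  fixes X :: "'a::euclidean_space set"
  assumes X: "closed X" and x: "x \<in> X" and t: "0 < t" and s: "s * norm w < d"
    and inward: "\<And>y. y \<in> X \<Longrightarrow> y \<notin> interior X \<Longrightarrow> dist y x < d \<Longrightarrow>
      \<exists>n \<in> inner_normals t (compl_set X) y. 0 < n \<bullet> w"
    and u: "0 \<le> u" "u \<le> s"
  shows "x + u *\<^sub>R w \<in> X"
proof (rule ccontr)
  assume out: "x + u *\<^sub>R w \<notin> X"
  define B where "B = {u. 0 \<le> u \<and> u \<le> s \<and> x + u *\<^sub>R w \<notin> X}"
  define i where "i = Inf B"
  have B: "B \<noteq> {}" "bdd_below B" using out u by (auto simp: B_def intro: bdd_belowI[of _ 0])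
  have i0: "0 \<le> i" unfolding i_def using B by (intro cInf_greatest) (auto simp: B_def)
  have "i \<le> u" unfolding i_def using out u B by (intro cInf_lower) (auto simp: B_def)
  \<comment> \<open>The complement of \<open>X\<close> is open, so a point outside at time
    \<open>i\<close> would have been outside slightly earlier.\<close>
  have iB: "i \<notin> B"
  proof
    assume "i \<in> B"
    then have "i > 0" using x i0 by (cases "i = 0") (auto simp: B_def)
    have "open ((\<lambda>u. x + u *\<^sub>R w) -` (- X))"
      using X by (intro open_vimage continuous_intros) auto
    moreover have "i \<in> (\<lambda>u. x + u *\<^sub>R w) -` (- X)"
      using \<open>i \<in> B\<close> by (simp add: B_def)
    ultimately obtain e where e: "0 < e" "ball i e \<subseteq> (\<lambda>u. x + u *\<^sub>R w) -` (- X)"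
      unfolding open_contains_ball by blast
    define j where "j = max 0 (i - e / 2)"
    have "j \<in> ball i e" "0 \<le> j" "j < i" using e \<open>i > 0\<close> by (auto simp: j_def dist_real_def)
    then have "j \<in> B" using e \<open>i \<in> B\<close> by (auto simp: B_def)
    then show False using \<open>j < i\<close> cInf_lower[OF _ B(2)] by (fastforce simp: i_def)
  qed
  define y where "y = x + i *\<^sub>R w"
  have y: "y \<in> X" using iB i0 \<open>i \<le> u\<close> u by (auto simp: B_def y_def)
  have "i * norm w \<le> s * norm w" using \<open>i \<le> u\<close> u by (intro mult_right_mono) auto
  then have yd: "dist y x < d" using s i0 by (simp add: y_def dist_norm)
  obtain e where e: "0 < e" "\<And>k. 0 < k \<Longrightarrow> k < e \<Longrightarrow> y + k *\<^sub>R w \<in> X"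
  proof (cases "y \<in> interior X")
    case True
    have "open ((\<lambda>k. y + k *\<^sub>R w) -` interior X)"
      by (intro open_vimage continuous_intros) auto
    then obtain e where "0 < e" "ball 0 e \<subseteq> (\<lambda>k. y + k *\<^sub>R w) -` interior X"
      using True by (metis (no_types, lifting) open_contains_ball add.right_neutral scaleR_zero_left vimageI)
    moreover have "k \<in> ball 0 e" if "0 < k" "k < e" for k
      using that by simp
    ultimately have "y + k *\<^sub>R w \<in> X" if "0 < k" "k < e" for k
      using that interior_subset[of X] by blast
    then show ?thesis using that[OF \<open>0 < e\<close>] by blast
  next
    case False
    then obtain n where n: "n \<in> inner_normals t (compl_set X) y" "0 < n \<bullet> w"
      using inward[OF y _ yd] by blast
    show ?thesis
    proof
      \<comment> \<open>Below this bound the gain \<open>2 * t * k * (n \<bullet> w)\<close> exceeds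
        the quadratic term, which puts \<open>y + k *\<^sub>R w\<close> in the ball about
        \<open>y + t *\<^sub>R n\<close>; adding 1 keeps the denominator positive.\<close>
      show "0 < 2 * t * (n \<bullet> w) / ((norm w)\<^sup>2 + 1)"
        using t n by (intro divide_pos_pos) (auto intro: add_nonneg_pos)
      fix k :: real assume k: "0 < k" "k < 2 * t * (n \<bullet> w) / ((norm w)\<^sup>2 + 1)"
      have "0 < (norm w)\<^sup>2 + 1" by (simp add: add_nonneg_pos)
      then have "k * (norm w)\<^sup>2 < 2 * t * (n \<bullet> w)"
        using k by (simp add: pos_less_divide_eq algebra_simps)
      then have "k * (k * (norm w)\<^sup>2) < k * (2 * t * (n \<bullet> w))"
        using k by simp
      moreover have "(norm (k *\<^sub>R w - t *\<^sub>R n))\<^sup>2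
          = k * (k * (norm w)\<^sup>2) - k * (2 * t * (n \<bullet> w)) + t\<^sup>2"
        using n by (subst power2_norm_diff_scaleR)
          (auto simp: inner_normals_def power_mult_distrib power2_eq_square[of k])
      ultimately have "(norm (k *\<^sub>R w - t *\<^sub>R n))\<^sup>2 < t\<^sup>2"
        by linarith
      then have "norm (k *\<^sub>R w - t *\<^sub>R n) < t"
        using t by (simp add: power2_less_imp_less)
      moreover have "dist (y + t *\<^sub>R n) (y + k *\<^sub>R w) = norm (k *\<^sub>R w - t *\<^sub>R n)"
        by (simp add: dist_norm norm_minus_commute)
      ultimately have "y + k *\<^sub>R w \<in> ball (y + t *\<^sub>R n) t"
        by simp
      then have "y + k *\<^sub>R w \<notin> compl_set X"
        using n(1) unfolding inner_normals_def by blast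
      then show "y + k *\<^sub>R w \<in> X"
        using closure_subset[of "- X"] unfolding compl_set_def by blast
    qed
  qed
  obtain b where b: "b \<in> B" "b < i + e"
    using cInf_lessD[OF B(1), of "i + e"] e by (auto simp: i_def)
  have "i \<le> b" unfolding i_def using b B by (intro cInf_lower)
  then have "i < b" using b(1) iB by (cases "i = b") auto
  then have "y + (b - i) *\<^sub>R w \<in> X" using b e by auto
  then show False using b by (simp add: B_def y_def algebra_simps)
qed

section \<open>Deformation by short pushes\<close>

text \<open>Partition of unity over a finite cover by half-radius balls. The other half of each
  radius provides the uniform \<open>d\<close>, also for \<open>y\<close> outside
  \<open>K\<close>.\<close>

lemma continuous_selection_of_locally_constant:
  fixes A :: "'a::metric_space \<Rightarrow> 'b::real_normed_vector set"
  assumes K: "compact K" and A: "\<And>y. convex (A y)"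
    and loc: "\<And>x. x \<in> K \<Longrightarrow> \<exists>w d. 0 < d \<and> (\<forall>y. dist y x < d \<longrightarrow> w \<in> A y)"
  obtains W d where "continuous_on K W" "0 < d"
    "\<And>x y. x \<in> K \<Longrightarrow> dist y x < d \<Longrightarrow> W x \<in> A y"
proof -
  obtain w d where wd: "\<And>x. x \<in> K \<Longrightarrow> 0 < d x" "\<And>x y. x \<in> K \<Longrightarrow> dist y x < d x \<Longrightarrow> w x \<in> A y"
    using loc by metis
  have "\<And>x. x \<in> K \<Longrightarrow> open (ball x (d x / 2))" "K \<subseteq> (\<Union>x\<in>K. ball x (d x / 2))"
    using wd(1) by (auto intro!: bexI)
  then obtain T where T: "T \<subseteq> K" "finite T" "K \<subseteq> (\<Union>x\<in>T. ball x (d x / 2))"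
    using compactE_image[OF K, of K "\<lambda>x. ball x (d x / 2)"] by metis
  define \<phi> where "\<phi> i y = max 0 (d i / 2 - dist y i)" for i y
  define s where "s y = (\<Sum>i\<in>T. \<phi> i y)" for y
  have \<phi>0: "0 \<le> \<phi> i y" for i y by (simp add: \<phi>_def)
  have spos: "0 < s y" if y: "y \<in> K" for y
  proof -
    obtain i where i: "i \<in> T" "y \<in> ball i (d i / 2)" using T(3) y by auto
    then have "0 < \<phi> i y" by (simp add: \<phi>_def dist_commute)
    also have "\<phi> i y \<le> s y"
      unfolding s_def using T(2) i(1) \<phi>0 by (intro member_le_sum) auto
    finally show ?thesis .
  qed
  define W where "W y = (\<Sum>i\<in>T. (\<phi> i y / s y) *\<^sub>R w i)" for y
  \<comment> \<open>The element 1 covers the case of an empty \<open>T\<close>.\<close>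
  define e where "e = Min (insert 1 ((\<lambda>i. d i / 2) ` T))"
  have e: "e \<le> d i / 2" if "i \<in> T" for i
    unfolding e_def using T(2) that by (intro Min_le) auto
  show thesis
  proof
    show "continuous_on K W"
      unfolding W_def s_def \<phi>_def using spos
      by (intro continuous_intros) (auto simp: s_def \<phi>_def less_le)
    show "0 < e"
      unfolding e_def using T wd(1) by (subst Min_gr_iff) auto
    fix x y assume x: "x \<in> K" and y: "dist y x < e"
    \<comment> \<open>Only centres with positive weight count: \<open>x\<close> is in their
      half-radius balls, so \<open>y\<close> is in the full ones.\<close>
    define T' where "T' = {i \<in> T. 0 < \<phi> i x}"
    have T': "finite T'" "T' \<subseteq> T" and zero: "\<And>i. i \<in> T - T' \<Longrightarrow> \<phi> i x = 0"
      using T(2) \<phi>0 by (auto simp: T'_def less_le)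
    have W: "W x = (\<Sum>i\<in>T'. (\<phi> i x / s x) *\<^sub>R w i)"
      unfolding W_def using T' zero by (intro sum.mono_neutral_right T(2)) auto
    have s: "s x = (\<Sum>i\<in>T'. \<phi> i x)"
      unfolding s_def using T' zero by (intro sum.mono_neutral_right T(2)) auto
    show "W x \<in> A y"
      unfolding W
    proof (rule convex_sum[OF T'(1) A])
      show "(\<Sum>i\<in>T'. \<phi> i x / s x) = 1"
        using spos[OF x] by (simp add: s flip: sum_divide_distrib)
      show "0 \<le> \<phi> i x / s x" for i
        using spos[OF x] \<phi>0 by simp
      fix i assume i: "i \<in> T'"
      then have "dist x i < d i / 2" "i \<in> T" by (auto simp: T'_def \<phi>_def)
      then have "dist y i < d i"
        using dist_triangle[of y i x] y e[of i] by linarith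
      then show "w i \<in> A y" using wd(2) \<open>i \<in> T\<close> T(1) by blast
    qed
  qed
qed

text \<open>Each point is pushed until it hits the level \<open>a\<close> or time
  \<open>\<epsilon>\<close> is over; strict descent makes this stopping time unique, and hence
  continuous.\<close>

lemma deformation_by_descending_push:
  fixes f :: "'a::euclidean_space \<Rightarrow> real"
  assumes X: "closed X" and f: "continuous_on UNIV f" and \<epsilon>: "0 < \<epsilon>" and ab: "a \<le> b"
    and K: "K = X \<inter> f -` {a..b}"
    and p: "continuous_on (K \<times> {0..\<epsilon>}) (\<lambda>(x, s). p x s)"
      "\<And>x. x \<in> K \<Longrightarrow> p x 0 = x"
      "\<And>x s. x \<in> K \<Longrightarrow> 0 \<le> s \<Longrightarrow> s \<le> \<epsilon> \<Longrightarrow> p x s \<in> X"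
      "\<And>x s s'. x \<in> K \<Longrightarrow> 0 \<le> s \<Longrightarrow> s \<le> s' \<Longrightarrow> s' \<le> \<epsilon> \<Longrightarrow> f (p x s') \<le> f (p x s) - (s' - s)"
  obtains r where "homotopic_with_canon (\<lambda>x. True) (X \<inter> f -` {..b}) (X \<inter> f -` {..b}) id r"
    "\<And>x. f x \<le> a \<Longrightarrow> r x = x"
    "\<And>x. x \<in> X \<inter> f -` {..b} \<Longrightarrow> f (r x) \<le> max a (f x - \<epsilon>)"
proof -
  define I where "I = {0..\<epsilon>}"
  define q where "q = (\<lambda>z. f (p (fst z) (snd z)))"
  have q: "continuous_on (K \<times> I) q"
    unfolding q_def using continuous_on_compose2[OF f p(1)] by (auto simp: I_def split_def)
  have qx: "continuous_on I (\<lambda>s. f (p x s))" if "x \<in> K" for x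
  proof -
    have "continuous_on I (\<lambda>s. q (x, s))"
      by (rule continuous_on_compose2[OF q]) (use that in \<open>auto intro!: continuous_intros\<close>)
    then show ?thesis by (simp add: q_def)
  qed
  \<comment> \<open>time until the level \<open>a\<close> is hit, capped by \<open>\<epsilon>\<close>\<close>
  define stop where "stop x s \<longleftrightarrow> s \<in> I \<and> (f (p x s) = a \<or> s = \<epsilon> \<and> a \<le> f (p x s))" for x s
  have ex: "\<exists>s. stop x s" if x: "x \<in> K" for x
  proof (cases "a \<le> f (p x \<epsilon>)")
    case True
    then have "stop x \<epsilon>" using \<epsilon> by (simp add: stop_def I_def)
    then show ?thesis ..
  next
    case False
    then have "\<exists>s. 0 \<le> s \<and> s \<le> \<epsilon> \<and> f (p x s) = a"
      using qx[OF x] \<epsilon> x p(2)[OF x] by (intro IVT2') (auto simp: I_def K)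
    then show ?thesis by (auto simp: stop_def I_def)
  qed
  \<comment> \<open>Stopping at \<open>s < s'\<close> means \<open>f (p x s) = a\<close>, so strict
    descent gives \<open>f (p x s') < a\<close>, which excludes stopping at
    \<open>s'\<close>.\<close>
  have not_less: "\<not> s < s'" if "x \<in> K" "stop x s" "stop x s'" for x s s'
    using that p(4)[of x s s'] by (force simp: stop_def I_def)
  then have uniq: "s = s'" if "x \<in> K" "stop x s" "stop x s'" for x s s'
    using that by (meson linorder_neqE_linordered_idom)
  define \<sigma> where "\<sigma> x = (SOME s. stop x s)" for x
  have \<sigma>: "stop x (\<sigma> x)" if "x \<in> K" for x
    unfolding \<sigma>_def using ex[OF that] by (rule someI_ex)
  have \<sigma>I: "0 \<le> \<sigma> x" "\<sigma> x \<le> \<epsilon>" if "x \<in> K" for x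
    using \<sigma>[OF that] by (auto simp: stop_def I_def)
  have closedK: "closed K"
    unfolding K by (intro closed_Int X closed_vimage f) auto
  \<comment> \<open>The graph is cut out by a closed condition and the values lie in a compact
    interval.\<close>
  have cont\<sigma>: "continuous_on K \<sigma>"
  proof (rule continuous_from_closed_graph[of I])
    show "compact I" "\<sigma> \<in> K \<rightarrow> I" using \<sigma>I by (auto simp: I_def)
    have "s = \<sigma> x \<longleftrightarrow> stop x s" if "x \<in> K" for x s
      using \<sigma> uniq that by blast
    then have "(\<lambda>x. (x, \<sigma> x)) ` K = {(x, s). x \<in> K \<and> stop x s}"
      by auto
    also have "\<dots> = (K \<times> I) \<inter> (\<lambda>z. (q z, snd z)) -` ({a} \<times> UNIV \<union> {a..} \<times> {\<epsilon>})"
      by (auto simp: q_def stop_def)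
    finally have "(\<lambda>x. (x, \<sigma> x)) ` K
      = (K \<times> I) \<inter> (\<lambda>z. (q z, snd z)) -` ({a} \<times> UNIV \<union> {a..} \<times> {\<epsilon>})" .
    moreover have "closed \<dots>"
    proof (rule continuous_closed_preimage)
      show "continuous_on (K \<times> I) (\<lambda>z. (q z, snd z))"
        by (intro continuous_intros q)
      show "closed (K \<times> I)" using closedK by (auto simp: I_def intro: closed_Times)
      show "closed ({a} \<times> (UNIV :: real set) \<union> {a..} \<times> {\<epsilon>})"
        by (intro closed_Un closed_Times) auto
    qed
    ultimately show "closed ((\<lambda>x. (x, \<sigma> x)) ` K)" by simp
  qed
  define L where "L = X \<inter> f -` {..a}"
  have closedL: "closed L"
    unfolding L_def by (intro closed_Int X closed_vimage f) auto
  have Xb: "X \<inter> f -` {..b} = L \<union> K" using ab by (auto simp: L_def K)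
  \<comment> \<open>At homotopy time \<open>t\<close> a point has used the fraction \<open>t\<close>
    of its stopping time; points at or below the level \<open>a\<close> rest.\<close>
  define H where "H z = (if f (snd z) \<le> a then snd z else p (snd z) (fst z * \<sigma> (snd z)))" for z :: "real \<times> 'a"
  have tI: "0 \<le> t * \<sigma> x \<and> t * \<sigma> x \<le> \<epsilon>" if "x \<in> K" "t \<in> {0..1}" for x t
    using \<sigma>I[OF that(1)] that(2) mult_left_le_one_le[of "\<sigma> x" t] by auto
  have contH: "continuous_on ({0..1} \<times> (L \<union> K)) H"
    unfolding Sigma_Un_distrib2 H_def
  proof (rule continuous_on_cases)
    show "closed ({0..1::real} \<times> L)" "closed ({0..1::real} \<times> K)"
      by (auto intro: closed_Times closedK closedL)
    show "continuous_on ({0..1::real} \<times> L) snd"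
      by (intro continuous_intros)
    have "continuous_on ({0..1} \<times> K) (\<lambda>z. (snd z, fst z * \<sigma> (snd z)))"
      by (intro continuous_intros continuous_on_compose2[OF cont\<sigma>]) auto
    moreover have "(\<lambda>z. (snd z, fst z * \<sigma> (snd z))) ` ({0..1} \<times> K) \<subseteq> K \<times> {0..\<epsilon>}"
      using tI by fastforce
    ultimately show "continuous_on ({0..1} \<times> K) (\<lambda>z. p (snd z) (fst z * \<sigma> (snd z)))"
      using continuous_on_compose2[OF p(1), of "{0..1} \<times> K" "\<lambda>z. (snd z, fst z * \<sigma> (snd z))"]
      by simp
    \<comment> \<open>On the level \<open>a\<close>, where the two closed pieces meet, the stopping
      time is 0, so the branches agree.\<close>
    have "p x (t * \<sigma> x) = x" if x: "x \<in> K" "f x = a" for x t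
    proof -
      have "stop x 0" using p(2)[OF x(1)] x \<epsilon> by (simp add: stop_def I_def)
      then have "\<sigma> x = 0" using uniq \<sigma> x(1) by blast
      then show ?thesis using p(2)[OF x(1)] by simp
    qed
    then show "\<forall>z. z \<in> {0..1} \<times> L \<and> \<not> f (snd z) \<le> a \<or> z \<in> {0..1} \<times> K \<and> f (snd z) \<le> a \<longrightarrow>
        snd z = p (snd z) (fst z * \<sigma> (snd z))"
      by (auto simp: L_def K)
  qed
  have fH: "H (t, x) \<in> X \<and> f (H (t, x)) \<le> b" if "t \<in> {0..1}" "x \<in> L \<union> K" for t x
  proof (cases "f x \<le> a")
    case True
    then show ?thesis using that ab by (auto simp: H_def L_def K)
  next
    case False
    then have x: "x \<in> K" using that by (auto simp: L_def)
    then show ?thesis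
      using tI[OF x that(1)] p(2)[OF x] p(3)[OF x] p(4)[OF x, of 0 "t * \<sigma> x"] False
      by (auto simp: H_def K)
  qed
  define r where "r x = H (1, x)" for x
  show thesis
  proof
    show "homotopic_with_canon (\<lambda>x. True) (X \<inter> f -` {..b}) (X \<inter> f -` {..b}) id r"
    proof (subst homotopic_with)
      have "H \<in> {0..1} \<times> (L \<union> K) \<rightarrow> X \<inter> f -` {..b}"
        using fH by auto
      with contH have "continuous_map (prod_topology (top_of_set {0..1}) (top_of_set (X \<inter> f -` {..b})))
          (top_of_set (X \<inter> f -` {..b})) H"
        unfolding Xb[symmetric]
        by (simp add: euclidean_product_topology flip: subtopology_Times)
      moreover have "H (0, x) = id x" if "x \<in> X \<inter> f -` {..b}" for x
        using that p(2)[of x] by (auto simp: H_def K)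
      ultimately show "\<exists>h. continuous_map (prod_topology (top_of_set {0..1::real}) (top_of_set (X \<inter> f -` {..b})))
          (top_of_set (X \<inter> f -` {..b})) h
          \<and> (\<forall>x\<in>topspace (top_of_set (X \<inter> f -` {..b})). h (0, x) = id x)
          \<and> (\<forall>x\<in>topspace (top_of_set (X \<inter> f -` {..b})). h (1, x) = r x) \<and> (\<forall>t\<in>{0..1::real}. True)"
        by (intro exI[of _ H]) (simp add: r_def)
    qed simp
    show "r x = x" if "f x \<le> a" for x
      using that by (simp add: r_def H_def)
    fix x assume x: "x \<in> X \<inter> f -` {..b}"
    show "f (r x) \<le> max a (f x - \<epsilon>)"
    proof (cases "f x \<le> a")
      case False
      then have xK: "x \<in> K" using x by (auto simp: K)
      then have "f (p x (\<sigma> x)) = a \<or> f (p x (\<sigma> x)) \<le> f x - \<epsilon>"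
        using \<sigma>[OF xK] p(4)[OF xK, of 0 "\<epsilon>"] p(2)[OF xK] \<epsilon> by (auto simp: stop_def)
      then show ?thesis using False by (auto simp: r_def H_def)
    qed (simp add: r_def H_def)
  qed
qed

text \<open>Composing the deformation with \<open>r ^^ n\<close> on the right appends one more push,
  which lowers \<open>f\<close> by \<open>\<epsilon>\<close> or down to \<open>a\<close>.\<close>

lemma iterate_deformation:
  fixes f :: "'a::topological_space \<Rightarrow> real"
  assumes r: "homotopic_with_canon (\<lambda>x. True) S S id r" "\<And>x. f x \<le> a \<Longrightarrow> r x = x"
      "\<And>x. x \<in> S \<Longrightarrow> f (r x) \<le> max a (f x - \<epsilon>)"
    and \<epsilon>: "0 < \<epsilon>"
  shows "homotopic_with_canon (\<lambda>x. True) S S id (r ^^ n) \<and> (\<forall>x. f x \<le> a \<longrightarrow> (r ^^ n) x = x)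
    \<and> (\<forall>x\<in>S. f ((r ^^ n) x) \<le> max a (f x - real n * \<epsilon>))"
proof (induction n)
  case 0
  show ?case by (simp add: homotopic_with_refl[unfolded eq_id_iff] id_def)
next
  case (Suc n)
  have cont: "continuous_on S (r ^^ n)" "(r ^^ n) \<in> S \<rightarrow> S"
    using Suc.IH homotopic_with_imp_continuous homotopic_with_imp_funspace2 by blast+
  have "homotopic_with_canon (\<lambda>x. True) S S (id \<circ> (r ^^ n)) (r \<circ> (r ^^ n))"
    by (rule homotopic_with_compose_continuous_right[OF r(1) cont])
  with Suc.IH have "homotopic_with_canon (\<lambda>x. True) S S id (r \<circ> (r ^^ n))"
    by (metis homotopic_with_trans id_comp)
  then have "homotopic_with_canon (\<lambda>x. True) S S id (r ^^ Suc n)"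
    by simp
  moreover have "f ((r ^^ Suc n) x) \<le> max a (f x - real (Suc n) * \<epsilon>)" if "x \<in> S" for x
  proof -
    have "f ((r ^^ Suc n) x) \<le> max a (f ((r ^^ n) x) - \<epsilon>)"
      using r(3)[of "(r ^^ n) x"] cont(2) that by auto
    also have "\<dots> \<le> max a (max a (f x - real n * \<epsilon>) - \<epsilon>)"
      using Suc.IH that by (intro max.mono) auto
    also have "\<dots> \<le> max a (f x - real (Suc n) * \<epsilon>)"
      using \<epsilon> by (auto simp: algebra_simps)
    finally show ?thesis .
  qed
  moreover have "(r ^^ Suc n) x = x" if "f x \<le> a" for x
    using Suc.IH r(2) that by simp
  ultimately show ?case by blast
qed

lemma gderiv_along_line:
  fixes f :: "'a::real_inner \<Rightarrow> real"
  assumes "GDERIV f (x + u *\<^sub>R w) :> D"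
  shows "((\<lambda>u. f (x + u *\<^sub>R w)) has_real_derivative (D \<bullet> w)) (at u)"
proof -
  have "(f has_derivative (\<lambda>h. h \<bullet> D)) (at (x + u *\<^sub>R w))"
    using assms by (simp add: gderiv_def)
  moreover have "((\<lambda>u. x + u *\<^sub>R w) has_derivative (\<lambda>h. h *\<^sub>R w)) (at u)"
    by (auto intro!: derivative_eq_intros)
  ultimately have "((\<lambda>u. f (x + u *\<^sub>R w)) has_derivative (\<lambda>h. (h *\<^sub>R w) \<bullet> D)) (at u)"
    using has_derivative_compose[of "\<lambda>u. x + u *\<^sub>R w" _ u UNIV f] by blast
  then show ?thesis
    by (simp add: has_field_derivative_def inner_commute mult_commute_abs)
qed

theorem mainTheorem4:
  fixes X :: "'a::euclidean_space set" and f :: "'a \<Rightarrow> real" and a b :: real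
  assumes "complementary_regular X"
    and "C2 f"
    and "a < b"
    and "\<forall>t\<in>{a..b}. regular_value f X t"
  shows "\<exists>r. homotopic_with_canon (\<lambda>x. True) (X \<inter> f -` {..b}) (X \<inter> f -` {..b}) id r
             \<and> retraction (X \<inter> f -` {..b}) (X \<inter> f -` {..a}) r"
proof -
  let ?C = "compl_set X"
  have X: "compact X" "closed X" "closure (interior X) = X" and reachC: "0 < reach ?C"
    using assms(1) compact_imp_closed by (auto simp: complementary_regular_def)
  obtain \<mu> where \<mu>: "0 < \<mu>" "0 < reach_mu \<mu> X"
    using assms(1) by (auto simp: complementary_regular_def)
  obtain \<sigma> where \<sigma>: "0 < \<sigma>"
    "\<And>x. 0 < infdist x X \<Longrightarrow> infdist x X \<le> \<sigma> \<Longrightarrow> \<mu> \<le> Delta (clarke_grad (\<lambda>y. infdist y X) x)"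
    using reach_mu_pos_imp_steep[OF \<mu>(2)] by metis
  obtain \<rho> where \<rho>: "0 < \<rho>" "\<And>x. infdist x ?C < \<rho> \<Longrightarrow> \<exists>!a. a \<in> ?C \<and> dist x a = infdist x ?C"
    using reach_pos_imp_unique_nearest[OF reachC] by metis
  define t where "t = \<rho> / 2"
  have t: "0 < t" "t < \<rho>" using \<rho>(1) by (auto simp: t_def)
  have C: "?C = - interior X" by (simp add: compl_set_def closure_complement)
  obtain g H where g: "\<And>x. GDERIV f x :> g x" and H: "\<And>x. (g has_derivative blinfun_apply (H x)) (at x)"
    using assms(2) unfolding C2_def by metis
  have contf: "continuous_on UNIV f"
    using g unfolding gderiv_def
    by (meson continuous_at_imp_continuous_on has_derivative_continuous)
  have contg: "isCont g x" for x
    using H has_derivative_continuous by blast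
  define K where "K = X \<inter> f -` {a..b}"
  have K: "compact K"
    unfolding K_def using X(1) by (intro compact_Int_closed closed_vimage contf) auto
  \<comment> \<open>Admissible velocities at \<open>y\<close>, given by linear inequalities.
    Normalizing the descent rate to 1 makes elapsed time a lower bound for the drop of
    \<open>f\<close>.\<close>
  define A where "A y = {w. g y \<bullet> w \<le> - 1 \<and>
      (y \<in> X - interior X \<longrightarrow> (\<forall>n \<in> inner_normals t ?C y. 0 < n \<bullet> w))}" for y
  have convA: "convex (A y)" for y
  proof (rule convexI)
    fix v w u u' assume v: "v \<in> A y" and w: "w \<in> A y" and u: "0 \<le> u" "0 \<le> u'" "u + u' = (1::real)"
    have "u * (g y \<bullet> v) + u' * (g y \<bullet> w) \<le> u * (- 1) + u' * (- 1)"
      using v w u by (intro add_mono mult_left_mono) (auto simp: A_def)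
    moreover have "0 < u * (n \<bullet> v) + u' * (n \<bullet> w)" if "0 < n \<bullet> v" "0 < n \<bullet> w" for n
    proof (cases "u = 0")
      case False
      then show ?thesis using that u by (intro add_pos_nonneg) auto
    qed (use that u in simp)
    ultimately show "u *\<^sub>R v + u' *\<^sub>R w \<in> A y"
      using v w u by (auto simp: A_def inner_add_right)
  qed
  have loc: "\<exists>w d. 0 < d \<and> (\<forall>y. dist y x < d \<longrightarrow> w \<in> A y)" if x: "x \<in> K" for x
  proof -
    have "regular_value f X (f x)" "x \<in> X" using x assms(4) by (auto simp: K_def)
    then have nor: "g x \<notin> uminus ` nor_cr X x"
      using g unfolding regular_value_def critical_point_def by blast
    \<comment> \<open>In the interior, regularity says \<open>g x\<close> is nonzero, and
      \<open>- g x\<close> serves. On the boundary the two sign changes cancel, so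
      \<open>g x\<close> is not normal to \<open>?C\<close>.\<close>
    obtain w d where w: "g x \<bullet> w < 0" and d: "0 < d"
      "\<And>y n. dist y x < d \<Longrightarrow> y \<in> X - interior X \<Longrightarrow> n \<in> inner_normals t ?C y \<Longrightarrow> 0 < n \<bullet> w"
    proof (cases "x \<in> interior X")
      case True
      then obtain d where "0 < d" "ball x d \<subseteq> interior X"
        using open_contains_ball open_interior by blast
      moreover have "g x \<bullet> (- g x) < 0"
        using nor True by (auto simp: nor_cr_def)
      ultimately show ?thesis
        using that[of "- g x" d] by (metis DiffD2 dist_commute mem_ball subsetD)
    next
      case False
      then have "g x \<notin> nor_cone ?C x"
        using nor by (force simp: nor_cr_def image_iff)
      moreover have "x \<in> closure (- X)" using False by (simp add: closure_complement)
      ultimately obtain w where "g x \<bullet> w < 0" "\<And>n. n \<in> inner_normals t ?C x \<Longrightarrow> 0 < n \<bullet> w"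
        using descent_direction_into_set[OF X(2) \<mu>(1) \<sigma> \<open>x \<in> X\<close> _ t(1)] by metis
      moreover from this(2) obtain d where
        "0 < d" "\<And>y n. dist y x < d \<Longrightarrow> n \<in> inner_normals t ?C y \<Longrightarrow> 0 < n \<bullet> w"
        using inner_normals_positive_nearby by metis
      ultimately show ?thesis using that by blast
    qed
    \<comment> \<open>Half the descent rate at \<open>x\<close>: continuity keeps the rate at least
      \<open>c\<close> nearby, and dividing \<open>w\<close> by \<open>c\<close> normalizes
      it.\<close>
    define c where "c = - (g x \<bullet> w) / 2"
    have c: "0 < c" using w by (simp add: c_def)
    have "isCont (\<lambda>y. g y \<bullet> w) x"
      by (intro continuous_intros contg)
    then obtain d' where d': "0 < d'" "\<And>y. dist y x < d' \<Longrightarrow> dist (g y \<bullet> w) (g x \<bullet> w) < c"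
      using c unfolding continuous_at_eps_delta by metis
    have "(1 / c) *\<^sub>R w \<in> A y" if "dist y x < min d d'" for y
    proof -
      have "g y \<bullet> w \<le> - c"
        using d'(2)[of y] that by (simp add: dist_real_def c_def abs_less_iff)
      then show ?thesis
        using c d(2)[of y] that by (auto simp: A_def field_simps)
    qed
    then show ?thesis using d(1) d'(1) by (intro exI[of _ "(1 / c) *\<^sub>R w"] exI[of _ "min d d'"]) auto
  qed
  obtain W d where W: "continuous_on K W" "0 < d" "\<And>x y. x \<in> K \<Longrightarrow> dist y x < d \<Longrightarrow> W x \<in> A y"
    using continuous_selection_of_locally_constant[OF K convA loc] by metis
  obtain M where M: "0 < M" "\<And>x. x \<in> K \<Longrightarrow> norm (W x) \<le> M"
    using compact_imp_bounded[OF compact_continuous_image[OF W(1) K]] unfolding bounded_pos by auto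
  \<comment> \<open>Pushes up to time \<open>\<epsilon>\<close> have length at most
    \<open>d / 2\<close>, so \<open>W x\<close> stays admissible along the whole segment.\<close>
  define \<epsilon> where "\<epsilon> = d / (2 * M)"
  have \<epsilon>: "0 < \<epsilon>" using M W(2) by (simp add: \<epsilon>_def)
  have short: "s * norm (W x) < d" if "x \<in> K" "0 \<le> s" "s \<le> \<epsilon>" for x s
  proof -
    have "s * norm (W x) \<le> \<epsilon> * M" using that M \<epsilon> by (intro mult_mono) auto
    also have "\<dots> < d" using M W(2) by (simp add: \<epsilon>_def)
    finally show ?thesis .
  qed
  have stay: "x + s *\<^sub>R W x \<in> X" if x: "x \<in> K" and s: "0 \<le> s" "s \<le> \<epsilon>" for x s
  proof (rule segment_stays_in_set[OF X(2) _ t(1) short[OF x _ order_refl] _ s])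
    fix y assume y: "y \<in> X" "y \<notin> interior X" "dist y x < d"
    \<comment> \<open>Here \<open>closure (interior X) = X\<close> enters: \<open>y\<close> is a
      limit of points outside \<open>?C\<close>.\<close>
    have "inner_normals t ?C y \<noteq> {}"
      by (rule inner_normals_nonempty[OF _ \<rho>(2) t]) (use y X(3) in \<open>auto simp: C\<close>)
    then show "\<exists>n \<in> inner_normals t ?C y. 0 < n \<bullet> W x"
      using W(3)[OF x y(3)] y by (auto simp: A_def)
  qed (use x \<epsilon> in \<open>auto simp: K_def\<close>)
  have descend: "f (x + s' *\<^sub>R W x) \<le> f (x + s *\<^sub>R W x) - (s' - s)"
    if x: "x \<in> K" and s: "0 \<le> s" "s \<le> s'" "s' \<le> \<epsilon>" for x s s'
  proof -
    have "f (x + s' *\<^sub>R W x) + s' \<le> f (x + s *\<^sub>R W x) + s"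
    proof (rule DERIV_nonpos_imp_nonincreasing[OF s(2)])
      fix u assume u: "s \<le> u" "u \<le> s'"
      have "dist (x + u *\<^sub>R W x) x < d"
        using short[OF x, of u] u s by (simp add: dist_norm)
      then have "W x \<in> A (x + u *\<^sub>R W x)" by (rule W(3)[OF x])
      then have "g (x + u *\<^sub>R W x) \<bullet> W x + 1 \<le> 0" by (simp add: A_def)
      moreover have "((\<lambda>u. f (x + u *\<^sub>R W x) + u) has_real_derivative
          (g (x + u *\<^sub>R W x) \<bullet> W x + 1)) (at u)"
        by (intro DERIV_add gderiv_along_line g DERIV_ident)
      ultimately show "\<exists>D. ((\<lambda>u. f (x + u *\<^sub>R W x) + u) has_real_derivative D) (at u) \<and> D \<le> 0"
        by blast
    qed
    then show ?thesis by simp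
  qed
  have contp: "continuous_on (K \<times> {0..\<epsilon>}) (\<lambda>(x, s). x + s *\<^sub>R W x)"
    unfolding split_def by (intro continuous_intros continuous_on_compose2[OF W(1)]) auto
  obtain r where r: "homotopic_with_canon (\<lambda>x. True) (X \<inter> f -` {..b}) (X \<inter> f -` {..b}) id r"
    "\<And>x. f x \<le> a \<Longrightarrow> r x = x"
    "\<And>x. x \<in> X \<inter> f -` {..b} \<Longrightarrow> f (r x) \<le> max a (f x - \<epsilon>)"
    using deformation_by_descending_push[OF X(2) contf \<epsilon> less_imp_le[OF assms(3)] K_def contp _ stay descend]
    by auto
  \<comment> \<open>Enough pushes to bring even the level \<open>b\<close> down to
    \<open>a\<close>.\<close>
  obtain n where n: "b - a < real n * \<epsilon>"
    using reals_Archimedean3[OF \<epsilon>] by blast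
  note rn = iterate_deformation[where f = f and n = n, OF r \<epsilon>]
  have "retraction (X \<inter> f -` {..b}) (X \<inter> f -` {..a}) (r ^^ n)"
    unfolding retraction_def
  proof (intro conjI)
    show "X \<inter> f -` {..a} \<subseteq> X \<inter> f -` {..b}" using assms(3) by auto
    show "continuous_on (X \<inter> f -` {..b}) (r ^^ n)"
      using rn homotopic_with_imp_continuous by blast
    have "(r ^^ n) \<in> X \<inter> f -` {..b} \<rightarrow> X \<inter> f -` {..b}"
      using rn homotopic_with_imp_funspace2 by blast
    then show "r ^^ n \<in> X \<inter> f -` {..b} \<rightarrow> X \<inter> f -` {..a}"
      using rn n by fastforce
    show "\<forall>x\<in>X \<inter> f -` {..a}. (r ^^ n) x = x" using rn by simp
  qed
  then show ?thesis using rn by blast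
qed

end
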